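(* Let $a>0$, let $c_0<1$ be real, let $c=\{s\in\mathbb{C}:\operatorname{Re}s=c_0\}$, and let $f\in\mathcal{M}^{-1}(L_c)$ with associated function $f^*\in L_1(c)$. Consider $$(Ff)(z)=\int_0^\infty t^{-z}f(t)e^{-at}\,dt .$$ Then the transformation $F$ is well-defined and $(Ff)(z)$ is analytic in the half-plane $\operatorname{Re}z<1-c_0$. Moreover, for $\operatorname{Re}z<1-c_0$, $$(Ff)(z)=\frac{1}{2\pi i}\int_{c_0-i\infty}^{c_0+i\infty}\Gamma(1-s-z)f^*(s)a^{z+s-1}\,ds,$$ and, for every fixed value $\operatorname{Re}z<1-c_0$, the operator $F:\mathcal{M}^{-1}(L_c)\to L_1(\operatorname{Re}z-i\infty,\operatorname{Re}z+i\infty)$ is bounded, with norm satisfying $$\|F\|\le a^{\operatorname{Re}z+c_0-1}\int_{-\infty}^{\infty}|\Gamma(1-c_0-\operatorname{Re}z-i\tau)|\,d\tau .$$ Finally, for every real $\gamma<1-c_0$ and all $x>0$ the inversion formula $$f(x)=\frac{e^{ax}}{2\pi i}\int_{\gamma-i\infty}^{\gamma+i\infty}(Ff)(z)\,x^{z-1}\,dz$$ holds.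
   Context: For real $c_0$ let $c=\{s\in\mathbb{C}:\operatorname{Re}s=c_0\}$. $\mathcal{M}^{-1}(L_c)$ denotes the space of functions $f(x)$, $x>0$, representable as $$f(x)=\frac{1}{2\pi i}\int_c f^*(s)x^{-s}\,ds$$ with $f^*\in L_1(c)$ (integrable on the vertical line $c$). It is a Banach space with the norm $\|f\|_{\mathcal{M}^{-1}(L_c)}=\frac{1}{2\pi}\int_{-\infty}^{\infty}|f^*(c_0+it)|\,dt$. The function $f^*$ always denotes the one in this representation of $f$. For real $\gamma$, $L_1(\gamma-i\infty,\gamma+i\infty)$ is the space of functions $g$ on the vertical line $\operatorname{Re}z=\gamma$ with norm $\|g\|_1=\int_{-\infty}^{\infty}|g(\gamma+i\tau)|\,d\tau<\infty$. $\Gamma$ is Euler's gamma-function. *)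

theory Defs
  imports "HOL-Analysis.Analysis"
begin

section \<open>Functions on a vertical line\<close>

definition vline_L1 :: "real \<Rightarrow> (complex \<Rightarrow> complex) set" where
  "vline_L1 c = {g. integrable lebesgue (\<lambda>t. g (Complex c t))}"

definition vline_L1_norm :: "real \<Rightarrow> (complex \<Rightarrow> complex) \<Rightarrow> real" where
  "vline_L1_norm c g = (LINT t|lebesgue. cmod (g (Complex c t)))"

text \<open>The line is parametrised upwards by \<open>s = c + \<i> t\<close>, so \<open>ds = \<i> dt\<close>.\<close>

definition vline_integral :: "real \<Rightarrow> (complex \<Rightarrow> complex) \<Rightarrow> complex" where
  "vline_integral c g = \<i> * (LINT t|lebesgue. g (Complex c t))"

section \<open>Inverse Mellin transforms of integrable functions\<close>

text \<open>Elements of the space are functions on the positive half-line; the values of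
  \<open>f\<close> at arguments \<open>x \<le> 0\<close> are irrelevant.\<close>

definition mellin_rep :: "real \<Rightarrow> (real \<Rightarrow> complex) \<Rightarrow> (complex \<Rightarrow> complex) \<Rightarrow> bool" where
  "mellin_rep c f fs \<longleftrightarrow> fs \<in> vline_L1 c \<and>
     (\<forall>x>0. f x = 1 / (2 * of_real pi * \<i>) *
                   vline_integral c (\<lambda>s. fs s * of_real x powr (- s)))"

definition Minv :: "real \<Rightarrow> (real \<Rightarrow> complex) set" where
  "Minv c = {f. \<exists>fs. mellin_rep c f fs}"

text \<open>The representing function is unique up to null sets on the line (injectivity of the
  Fourier transform on integrable functions), so the norm does not depend on the choice.\<close>

definition Minv_norm :: "real \<Rightarrow> (real \<Rightarrow> complex) \<Rightarrow> real" where
  "Minv_norm c f = 1 / (2 * pi) * vline_L1_norm c (SOME fs. mellin_rep c f fs)"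

section \<open>Bounded operators from \<open>Minv c\<close> to \<open>vline_L1 \<gamma>\<close>\<close>

text \<open>Values of \<open>T f\<close> off the line \<open>Re z = \<gamma>\<close> play no role.\<close>

definition bounded_operator ::
    "real \<Rightarrow> real \<Rightarrow> ((real \<Rightarrow> complex) \<Rightarrow> complex \<Rightarrow> complex) \<Rightarrow> bool" where
  "bounded_operator c \<gamma> T \<longleftrightarrow>
     (\<forall>f\<in>Minv c. T f \<in> vline_L1 \<gamma>) \<and>
     (\<forall>f\<in>Minv c. \<forall>g\<in>Minv c. \<forall>\<alpha> \<beta> z. Re z = \<gamma> \<longrightarrow>
        T (\<lambda>x. \<alpha> * f x + \<beta> * g x) z = \<alpha> * T f z + \<beta> * T g z) \<and>
     (\<exists>K. \<forall>f\<in>Minv c. vline_L1_norm \<gamma> (T f) \<le> K * Minv_norm c f)"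

text \<open>The operator norm, as the best constant in the boundedness estimate.\<close>

definition operator_norm ::
    "real \<Rightarrow> real \<Rightarrow> ((real \<Rightarrow> complex) \<Rightarrow> complex \<Rightarrow> complex) \<Rightarrow> real" where
  "operator_norm c \<gamma> T =
     Inf {K. 0 \<le> K \<and> (\<forall>f\<in>Minv c. vline_L1_norm \<gamma> (T f) \<le> K * Minv_norm c f)}"

section \<open>The transformation\<close>

definition F_integrand :: "real \<Rightarrow> (real \<Rightarrow> complex) \<Rightarrow> complex \<Rightarrow> real \<Rightarrow> complex" where
  "F_integrand a f z t = of_real t powr (- z) * f t * of_real (exp (- a * t))"

definition F_transform :: "real \<Rightarrow> (real \<Rightarrow> complex) \<Rightarrow> complex \<Rightarrow> complex" where
  "F_transform a f z = (LINT t:{0<..}|lebesgue. F_integrand a f z t)"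

end

theory Submission
  imports Defs "HOL-Probability.Probability" "HOL-Complex_Analysis.Complex_Analysis"
begin

text \<open>
  In the variable \<open>w = ln t\<close> everything becomes Fourier analysis on the real line. Write
  \<open>h u = f\<^sup>* (c\<^sub>0 + \<i> u)\<close> and \<open>H\<close> for its Fourier transform. The Mellin representation of \<open>f\<close> says
  \<open>exp (c\<^sub>0 w) f (exp w) = H w / (2 \<pi>)\<close>, which is a bounded continuous function, and the
  substitution \<open>t = exp w\<close> turns the transformation into
  \<open>F f z = (1 / 2 \<pi>) \<integral> H w K\<^sub>b w dw\<close> with \<open>b = 1 - c\<^sub>0 - z\<close> and the kernel
  \<open>K\<^sub>b w = exp (b w - a exp w)\<close>. The kernel is integrable for \<open>Re b > 0\<close>, because Euler's integral
  in the same variable reads \<open>\<integral> K\<^sub>b w dw = \<Gamma> b a\<^sup>-\<^sup>b\<close>. The parts of the theorem follow from this one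
  formula.

  \<^item> Well-definedness is the integrability of the kernel against the bounded function \<open>H\<close>.
    Analyticity follows since the truncated integrals over \<open>[-n, n]\<close> are entire in \<open>z\<close> and converge
    locally uniformly (\<open>F_transform_holomorphic\<close>).

  \<^item> Multiplying \<open>K\<^sub>b\<close> by the character \<open>exp (-\<i> u w)\<close> replaces \<open>b\<close> by \<open>b - \<i> u\<close>. Hence the Fourier
    transform of \<open>K\<^sub>b\<close> is \<open>\<Gamma> (b - \<i> u)\<close> times the power \<open>-(b - \<i> u)\<close> of \<open>a\<close>, and moving the
    Fourier transform from \<open>h\<close> to the kernel (\<open>fourier_multiplication\<close>) gives the vertical line integral for \<open>F f z\<close>.

  \<^item> On a vertical line \<open>Re z = \<gamma>\<close> this integral is a correlation of \<open>h\<close> with a Gamma factor, so its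
    \<open>L\<^sub>1\<close> norm is at most the product of the two norms (\<open>correlation_L1_norm_le\<close>). The Gamma factor
    is integrable since \<open>\<Gamma> s = \<Gamma> (s + 2) / (s (s + 1))\<close> decays quadratically
    (\<open>integrable_Gamma_vertical\<close>). The resulting estimate holds with any representing function of
    \<open>f\<close>, in particular with the one that the norm of \<open>f\<close> selects.

  \<^item> For fixed \<open>\<gamma>\<close>, the function \<open>\<tau> \<mapsto> F f (\<gamma> + \<i> \<tau>)\<close> is itself the Fourier transform of the bounded
    continuous integrable function \<open>H K / (2 \<pi>)\<close>, and it is integrable by the previous point. So the
    pointwise Fourier inversion theorem applies (\<open>fourier_inversion\<close>), and it is the claimed
    inversion formula after undoing the substitution.
\<close>

section \<open>Fourier inversion on the real line\<close>

text \<open>The Gaussian is, up to its normalisation, the standard normal density, whose characteristic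
  function is known.\<close>

lemma gaussian_fourier_integral:
  shows "integrable lborel (\<lambda>x. complex_of_real (exp (- x\<^sup>2 / 2)))"
    and "(LINT x|lborel. complex_of_real (exp (- x\<^sup>2 / 2)) * exp (\<i> * of_real (t * x)))
           = of_real (sqrt (2 * pi) * exp (- t\<^sup>2 / 2))"
proof -
  have dens: "exp (- x\<^sup>2 / 2) = sqrt (2 * pi) * std_normal_density x" for x
    by (simp add: std_normal_density_def)
  show "integrable lborel (\<lambda>x. complex_of_real (exp (- x\<^sup>2 / 2)))"
    unfolding dens using integrable_std_normal_moment[of 0] by (intro integrable_of_real) simp
  have "char std_normal_distribution t
      = (LINT x|lborel. std_normal_density x *\<^sub>R exp (\<i> * of_real (t * x)))"
    unfolding char_def by (subst integral_density) auto
  hence "(LINT x|lborel. std_normal_density x *\<^sub>R exp (\<i> * of_real (t * x))) = of_real (exp (- t\<^sup>2 / 2))"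
    by (simp add: char_std_normal_distribution)
  hence "sqrt (2 * pi) *\<^sub>R (LINT x|lborel. std_normal_density x *\<^sub>R exp (\<i> * of_real (t * x)))
      = of_real (sqrt (2 * pi) * exp (- t\<^sup>2 / 2))"
    by (simp add: scaleR_conv_of_real)
  thus "(LINT x|lborel. complex_of_real (exp (- x\<^sup>2 / 2)) * exp (\<i> * of_real (t * x)))
           = of_real (sqrt (2 * pi) * exp (- t\<^sup>2 / 2))"
    unfolding dens by (simp add: scaleR_conv_of_real mult.assoc)
qed

lemma gaussian_fourier_integral_scaled:
  assumes "\<epsilon> > 0"
  shows "integrable lborel (\<lambda>x. complex_of_real (exp (- (\<epsilon> * x)\<^sup>2 / 2)))"
    and "(LINT x|lborel. complex_of_real (exp (- (\<epsilon> * x)\<^sup>2 / 2)) * exp (\<i> * of_real (t * x)))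
           = of_real (sqrt (2 * pi) / \<epsilon> * exp (- (t / \<epsilon>)\<^sup>2 / 2))"
proof -
  show "integrable lborel (\<lambda>x. complex_of_real (exp (- (\<epsilon> * x)\<^sup>2 / 2)))"
    using lborel_integrable_real_affine[OF gaussian_fourier_integral(1), of \<epsilon> 0] assms by simp
  have "of_real (sqrt (2 * pi) * exp (- (t / \<epsilon>)\<^sup>2 / 2)) =
      (LINT x|lborel. complex_of_real (exp (- x\<^sup>2 / 2)) * exp (\<i> * of_real (t / \<epsilon> * x)))"
    by (simp only: gaussian_fourier_integral(2))
  also have "\<dots> = \<epsilon> *\<^sub>R (LINT x|lborel. complex_of_real (exp (- (\<epsilon> * x)\<^sup>2 / 2)) * exp (\<i> * of_real (t * x)))"
    using assms by (subst lborel_integral_real_affine[where c = \<epsilon> and t = 0]) auto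
  finally show "(LINT x|lborel. complex_of_real (exp (- (\<epsilon> * x)\<^sup>2 / 2)) * exp (\<i> * of_real (t * x)))
           = of_real (sqrt (2 * pi) / \<epsilon> * exp (- (t / \<epsilon>)\<^sup>2 / 2))"
    using assms by (simp add: scaleR_conv_of_real field_simps)
qed

lemma norm_exp_i_of_real [simp]:
  "norm (exp (\<i> * of_real x)) = 1" "norm (exp (- (\<i> * of_real x))) = 1"
  by (auto simp: norm_exp_eq_Re)

lemma integrable_mult_bounded:
  fixes f k :: "'a \<Rightarrow> complex"
  assumes "integrable M f" "k \<in> borel_measurable M" "\<And>x. norm (k x) \<le> B"
  shows "integrable M (\<lambda>x. f x * k x)"
proof (rule Bochner_Integration.integrable_bound)
  show "integrable M (\<lambda>x. B *\<^sub>R f x)" using assms by simp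
  have "norm (f x * k x) \<le> norm (B *\<^sub>R f x)" for x
    using mult_right_mono[OF assms(3)[of x], of "norm (f x)"] assms(3)[of x] order_trans[OF norm_ge_zero[of "k x"] assms(3)]
    by (simp add: norm_mult mult.commute )
  thus "AE x in M. norm (f x * k x) \<le> norm (B *\<^sub>R f x)" by simp
qed (use assms borel_measurable_integrable[OF assms(1)] in measurable)

definition fourier :: "(real \<Rightarrow> complex) \<Rightarrow> real \<Rightarrow> complex" where
  "fourier g \<tau> = (LINT w|lborel. g w * exp (- (\<i> * of_real (\<tau> * w))))"

lemma fourier_norm_le: "norm (fourier g \<tau>) \<le> (LINT w|lborel. norm (g w))"
  unfolding fourier_def
  by (rule order_trans[OF integral_norm_bound]) (simp add: norm_mult)

lemma continuous_fourier:
  assumes g: "integrable lborel g"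
  shows "continuous_on UNIV (fourier g)"
proof -
  have [measurable]: "g \<in> borel_measurable borel" using borel_measurable_integrable[OF g] by simp
  have "(\<lambda>n. fourier g (X n)) \<longlonglongrightarrow> fourier g \<tau>" if X: "X \<longlonglongrightarrow> \<tau>" for X \<tau>
    unfolding fourier_def
  proof (rule integral_dominated_convergence[where w = "\<lambda>w. norm (g w)"])
    show "AE w in lborel. (\<lambda>n. g w * exp (- (\<i> * of_real (X n * w)))) \<longlonglongrightarrow>
        g w * exp (- (\<i> * of_real (\<tau> * w)))"
      by (intro always_eventually allI tendsto_intros X)
  qed (use g in \<open>auto simp: norm_mult\<close>)
  thus ?thesis
    by (intro continuous_at_imp_continuous_on ballI)
       (auto simp: continuous_at_sequentially o_def)
qed

text \<open>The Gaussian factor on the left makes the inverse Fourier integral absolutely convergent as a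
  double integral. After exchanging the order, the inner integral is the Fourier transform of a
  Gaussian, that is, again a Gaussian, now concentrated near \<open>y\<close> on the scale \<open>\<epsilon>\<close>.\<close>

lemma gaussian_mean_fourier:
  assumes g: "integrable lborel g" and G: "integrable lborel (fourier g)" and \<epsilon>: "\<epsilon> > 0"
  shows "(LINT \<tau>|lborel. fourier g \<tau> * exp (\<i> * of_real (\<tau> * y)) * of_real (exp (- (\<epsilon> * \<tau>)\<^sup>2 / 2)))
       = of_real (sqrt (2 * pi)) * (LINT r|lborel. g (y + \<epsilon> * r) * of_real (exp (- r\<^sup>2 / 2)))"
proof -
  have [measurable]: "g \<in> borel_measurable borel" using borel_measurable_integrable[OF g] by simp
  define E where "E = (\<lambda>\<tau>. complex_of_real (exp (- (\<epsilon> * \<tau>)\<^sup>2 / 2)))"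
  have E: "integrable lborel E"
    unfolding E_def using \<epsilon> by (rule gaussian_fourier_integral_scaled)
  have [measurable]: "E \<in> borel_measurable borel" unfolding E_def by measurable
  define K where "K = (\<lambda>(w, \<tau>). g w * exp (\<i> * of_real ((y - w) * \<tau>)) * E \<tau>)"
  have [measurable]: "K \<in> borel_measurable (lborel \<Otimes>\<^sub>M lborel)"
    unfolding K_def by measurable
  have K: "integrable (lborel \<Otimes>\<^sub>M lborel) K"
  proof (rule lborel_pair.Fubini_integrable)
    have "norm (K (w, \<tau>)) = norm (g w) * norm (E \<tau>)" for w \<tau>
      unfolding K_def split norm_mult norm_exp_i_of_real by simp
    thus "integrable lborel (\<lambda>x. LINT \<tau>|lborel. norm (K (x, \<tau>)))"
      using g by simp
    have "integrable lborel (\<lambda>\<tau>. E \<tau> * (g w * exp (\<i> * of_real ((y - w) * \<tau>))))" for w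
      by (intro integrable_mult_bounded[where B = "norm (g w)"] E)
        (simp_all add: norm_mult del: of_real_mult of_real_diff)
    thus "AE x in lborel. integrable lborel (\<lambda>y. K (x, y))"
      unfolding K_def by (simp add: mult_ac)
  qed measurable
  have "(LINT \<tau>|lborel. fourier g \<tau> * exp (\<i> * of_real (\<tau> * y)) * E \<tau>)
      = (LINT \<tau>|lborel. LINT w|lborel. K (w, \<tau>))"
  proof (rule Bochner_Integration.integral_cong[OF refl])
    fix \<tau>
    have "K (w, \<tau>) = g w * exp (- (\<i> * of_real (\<tau> * w))) * (exp (\<i> * of_real (\<tau> * y)) * E \<tau>)" for w
    proof -
      have "exp (\<i> * of_real ((y - w) * \<tau>)) = exp (- (\<i> * of_real (\<tau> * w))) * exp (\<i> * of_real (\<tau> * y))"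
        by (simp add: algebra_simps flip: exp_add)
      thus ?thesis by (simp add: K_def)
    qed
    thus "fourier g \<tau> * exp (\<i> * of_real (\<tau> * y)) * E \<tau> = (LINT w|lborel. K (w, \<tau>))"
      by (simp only: fourier_def mult.assoc[symmetric] integral_mult_left_zero)
  qed
  also have "\<dots> = (LINT w|lborel. LINT \<tau>|lborel. K (w, \<tau>))"
    using K by (rule lborel_pair.Fubini_integral[of "\<lambda>w \<tau>. K (w, \<tau>)", simplified])
  also have "\<dots> = (LINT w|lborel. g w * of_real (sqrt (2 * pi) / \<epsilon> * exp (- ((y - w) / \<epsilon>)\<^sup>2 / 2)))"
  proof (rule Bochner_Integration.integral_cong[OF refl])
    fix w
    have "(LINT \<tau>|lborel. K (w, \<tau>)) = g w * (LINT \<tau>|lborel. E \<tau> * exp (\<i> * of_real ((y - w) * \<tau>)))"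
      unfolding K_def split by (subst integral_mult_right_zero[symmetric]) (simp add: mult_ac)
    thus "(LINT \<tau>|lborel. K (w, \<tau>)) = g w * of_real (sqrt (2 * pi) / \<epsilon> * exp (- ((y - w) / \<epsilon>)\<^sup>2 / 2))"
      unfolding E_def gaussian_fourier_integral_scaled(2)[OF \<epsilon>] .
  qed
  also have "\<dots> = \<epsilon> *\<^sub>R (LINT r|lborel. g (y + \<epsilon> * r) * of_real (sqrt (2 * pi) / \<epsilon> * exp (- r\<^sup>2 / 2)))"
    using \<epsilon> by (subst lborel_integral_real_affine[where c = \<epsilon> and t = y]) auto
  also have "\<dots> = (LINT r|lborel. of_real (sqrt (2 * pi)) * (g (y + \<epsilon> * r) * of_real (exp (- r\<^sup>2 / 2))))"
    using \<epsilon> by (subst integral_scaleR_right[symmetric]) (simp add: scaleR_conv_of_real field_simps)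
  finally show ?thesis
    unfolding E_def by (simp del: of_real_mult)
qed

text \<open>Let \<open>\<epsilon> \<rightarrow> 0\<close> in \<open>gaussian_mean_fourier\<close>. Integrability of the transform dominates the left side, and
  the bound on \<open>g\<close> dominates the right side, where continuity at the single point \<open>y\<close> gives the
  limit.\<close>

theorem fourier_inversion:
  assumes g: "integrable lborel g" and bdd: "\<And>w. norm (g w) \<le> B" and cont: "isCont g y"
    and G: "integrable lborel (fourier g)"
  shows "g y = 1 / (2 * of_real pi) * (LINT \<tau>|lborel. fourier g \<tau> * exp (\<i> * of_real (\<tau> * y)))"
proof -
  have [measurable]: "g \<in> borel_measurable borel" using borel_measurable_integrable[OF g] by simp
  have [measurable]: "fourier g \<in> borel_measurable borel"
    using borel_measurable_integrable[OF G] by simp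
  define e where "e = (\<lambda>n. inverse (real (Suc n)))"
  have e: "e \<longlonglongrightarrow> 0" unfolding e_def by (rule LIMSEQ_inverse_real_of_nat)
  define A where "A = (\<lambda>n. LINT \<tau>|lborel. fourier g \<tau> * exp (\<i> * of_real (\<tau> * y))
                            * of_real (exp (- (e n * \<tau>)\<^sup>2 / 2)))"
  have "A \<longlonglongrightarrow> (LINT \<tau>|lborel. fourier g \<tau> * exp (\<i> * of_real (\<tau> * y)))"
    unfolding A_def
  proof (rule integral_dominated_convergence[where w = "\<lambda>\<tau>. norm (fourier g \<tau>)"])
    have "(\<lambda>n. fourier g \<tau> * exp (\<i> * of_real (\<tau> * y)) * of_real (exp (- (e n * \<tau>)\<^sup>2 / 2))) \<longlonglongrightarrow>
        fourier g \<tau> * exp (\<i> * of_real (\<tau> * y)) * of_real (exp (- (0 * \<tau>)\<^sup>2 / 2))" for \<tau>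
      by (intro tendsto_intros e) auto
    thus "AE \<tau> in lborel. (\<lambda>n. fourier g \<tau> * exp (\<i> * of_real (\<tau> * y)) * of_real (exp (- (e n * \<tau>)\<^sup>2 / 2)))
        \<longlonglongrightarrow> fourier g \<tau> * exp (\<i> * of_real (\<tau> * y))" by simp
    have "norm (fourier g \<tau> * exp (\<i> * of_real (\<tau> * y)) * of_real (exp (- (e n * \<tau>)\<^sup>2 / 2)))
        \<le> norm (fourier g \<tau>)" for n \<tau>
      unfolding norm_mult norm_exp_i_of_real norm_of_real by (simp add: mult_left_le)
    thus "AE \<tau> in lborel. norm (fourier g \<tau> * exp (\<i> * of_real (\<tau> * y)) *
        of_real (exp (- (e n * \<tau>)\<^sup>2 / 2))) \<le> norm (fourier g \<tau>)" for n by simp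
  qed (use G in auto)
  moreover have "A \<longlonglongrightarrow> of_real (sqrt (2 * pi)) * (LINT r|lborel. g y * of_real (exp (- r\<^sup>2 / 2)))"
  proof -
    have A_eq: "A = (\<lambda>n. of_real (sqrt (2 * pi)) * (LINT r|lborel. g (y + e n * r) * of_real (exp (- r\<^sup>2 / 2))))"
      unfolding A_def by (intro ext gaussian_mean_fourier[OF g G]) (simp add: e_def)
    have "(\<lambda>n. LINT r|lborel. g (y + e n * r) * of_real (exp (- r\<^sup>2 / 2))) \<longlonglongrightarrow>
        (LINT r|lborel. g y * of_real (exp (- r\<^sup>2 / 2)))"
    proof (rule integral_dominated_convergence[where w = "\<lambda>r. B * exp (- r\<^sup>2 / 2)"])
      show "integrable lborel (\<lambda>r. B * exp (- r\<^sup>2 / 2))"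
        using integrable_norm[OF gaussian_fourier_integral(1)] by simp
      have "(\<lambda>n. y + e n * r) \<longlonglongrightarrow> y + 0 * r" for r by (intro tendsto_intros e)
      hence "(\<lambda>n. g (y + e n * r)) \<longlonglongrightarrow> g y" for r
        using isCont_tendsto_compose[OF cont, of "\<lambda>n. y + e n * r"] by simp
      thus "AE r in lborel. (\<lambda>n. g (y + e n * r) * of_real (exp (- r\<^sup>2 / 2))) \<longlonglongrightarrow>
          g y * of_real (exp (- r\<^sup>2 / 2))"
        by (intro always_eventually allI tendsto_mult tendsto_const)
      show "AE r in lborel. norm (g (y + e n * r) * of_real (exp (- r\<^sup>2 / 2))) \<le> B * exp (- r\<^sup>2 / 2)" for n
        using bdd by (auto simp: norm_mult)
    qed auto
    thus ?thesis unfolding A_eq by (rule tendsto_mult[OF tendsto_const])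
  qed
  ultimately have "(LINT \<tau>|lborel. fourier g \<tau> * exp (\<i> * of_real (\<tau> * y)))
      = of_real (sqrt (2 * pi)) * (LINT r|lborel. g y * of_real (exp (- r\<^sup>2 / 2)))"
    by (rule LIMSEQ_unique)
  also have "\<dots> = of_real (sqrt (2 * pi)) * (of_real (sqrt (2 * pi)) * g y)"
    using gaussian_fourier_integral(2)[of 0] by simp
  also have "\<dots> = of_real (sqrt (2 * pi) * sqrt (2 * pi)) * g y"
    by (simp only: of_real_mult mult.assoc)
  also have "sqrt (2 * pi) * sqrt (2 * pi) = 2 * pi" by simp
  finally show ?thesis by (simp del: real_sqrt_mult)
qed

section \<open>Lebesgue measure and the substitution by the exponential function\<close>

text \<open>Fubini's theorem is used for the product of Borel measures, whereas functions on vertical lines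
  are only Lebesgue measurable. They are therefore replaced by Borel functions that agree almost
  everywhere.\<close>

lemma integrable_lebesgue_borel_representative:
  fixes g :: "real \<Rightarrow> complex"
  assumes g: "integrable lebesgue g"
  obtains h where "integrable lborel h" "AE t in lebesgue. g t = h t"
proof -
  have gm: "g \<in> borel_measurable (completion lborel)"
    using borel_measurable_integrable[OF g] .
  have "(\<lambda>t. Re (g t)) \<in> borel_measurable (completion lborel)"
       "(\<lambda>t. Im (g t)) \<in> borel_measurable (completion lborel)"
    using gm by measurable
  from this[THEN completion_ex_borel_measurable_real] obtain r i where
    [measurable]: "r \<in> borel_measurable lborel" "i \<in> borel_measurable lborel" and
    ae: "AE t in lborel. Re (g t) = r t" "AE t in lborel. Im (g t) = i t"
    by blast
  define h where "h = (\<lambda>t. Complex (r t) (i t))"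
  have h_alt: "h = (\<lambda>t. of_real (r t) + \<i> * of_real (i t))"
    by (simp add: h_def complex_eq_iff fun_eq_iff)
  have hm: "h \<in> borel_measurable lborel"
    unfolding h_alt by measurable
  have "AE t in lborel. g t = h t"
    using ae by eventually_elim (simp add: h_def complex_eq_iff)
  hence ae': "AE t in lebesgue. g t = h t"
    by (rule AE_completion)
  have "integrable lebesgue h"
    using g by (rule integrable_cong_AE_imp) (use hm ae' in \<open>auto intro: measurable_completion\<close>)
  hence "integrable lborel h"
    using hm by (simp add: integrable_completion)
  thus ?thesis using ae' that by blast
qed

lemma lebesgue_mult_cong_representative:
  fixes g h k :: "real \<Rightarrow> complex"
  assumes g: "integrable lebesgue g" and h: "integrable lborel h"
    and ae: "AE t in lebesgue. g t = h t"
    and [measurable]: "k \<in> borel_measurable borel" and bdd: "\<And>t. norm (k t) \<le> B"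
  shows "integrable lebesgue (\<lambda>t. g t * k t)"
    and "integrable lborel (\<lambda>t. h t * k t)"
    and "(LINT t|lebesgue. g t * k t) = (LINT t|lborel. h t * k t)"
proof -
  have [measurable]: "h \<in> borel_measurable borel" using borel_measurable_integrable[OF h] by simp
  have gm: "g \<in> borel_measurable lebesgue" using borel_measurable_integrable[OF g] .
  have km: "k \<in> borel_measurable lebesgue" by (rule measurable_completion) simp
  show "integrable lebesgue (\<lambda>t. g t * k t)"
    using g km bdd by (rule integrable_mult_bounded)
  show "integrable lborel (\<lambda>t. h t * k t)"
    using h _ bdd by (rule integrable_mult_bounded) simp
  have hm: "(\<lambda>t. h t * k t) \<in> borel_measurable lborel" by measurable
  have "(LINT t|lebesgue. g t * k t) = (LINT t|lebesgue. h t * k t)"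
    by (rule integral_cong_AE)
       (use gm km hm ae in \<open>auto intro: borel_measurable_times measurable_completion\<close>)
  also have "\<dots> = (LINT t|lborel. h t * k t)"
    using hm by (rule integral_completion)
  finally show "(LINT t|lebesgue. g t * k t) = (LINT t|lborel. h t * k t)" .
qed

lemma set_lebesgue_exp_substitution:
  fixes f :: "real \<Rightarrow> complex"
  assumes [measurable]: "(\<lambda>w. exp w *\<^sub>R f (exp w)) \<in> borel_measurable borel"
  shows "set_integrable lebesgue {0<..} f \<longleftrightarrow> integrable lborel (\<lambda>w. exp w *\<^sub>R f (exp w))"
    and "integrable lborel (\<lambda>w. exp w *\<^sub>R f (exp w)) \<Longrightarrow>
           (LINT t:{0<..}|lebesgue. f t) = (LINT w|lborel. exp w *\<^sub>R f (exp w))"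
proof -
  have img: "exp ` (UNIV :: real set) = {0<..}"
    by (auto simp: image_iff) (metis exp_ln)
  have iff: "(\<lambda>w. \<bar>exp w\<bar> *\<^sub>R f (exp w)) absolutely_integrable_on UNIV \<and>
        integral UNIV (\<lambda>w. \<bar>exp w\<bar> *\<^sub>R f (exp w)) = b
      \<longleftrightarrow> f absolutely_integrable_on {0<..} \<and> integral {0<..} f = b" for b
    unfolding img[symmetric]
    by (rule has_absolute_integral_change_of_variables_real)
       (auto intro!: derivative_eq_intros simp: inj_on_def)
  have leb: "(\<lambda>w. exp w *\<^sub>R f (exp w)) absolutely_integrable_on UNIV
      \<longleftrightarrow> integrable lborel (\<lambda>w. exp w *\<^sub>R f (exp w))"
    by (simp add: set_integrable_def integrable_completion)
  show eq: "set_integrable lebesgue {0<..} f \<longleftrightarrow> integrable lborel (\<lambda>w. exp w *\<^sub>R f (exp w))"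
    using iff leb by (auto simp: set_integrable_def)
  assume int: "integrable lborel (\<lambda>w. exp w *\<^sub>R f (exp w))"
  have "(LINT t:{0<..}|lebesgue. f t) = integral {0<..} f"
    using eq int by (intro set_lebesgue_integral_eq_integral(2)) simp
  also have "\<dots> = integral UNIV (\<lambda>w. exp w *\<^sub>R f (exp w))"
    using iff leb int by auto
  also have "\<dots> = (LINT w|lebesgue. exp w *\<^sub>R f (exp w))"
    using set_lebesgue_integral_eq_integral(2)[of UNIV "\<lambda>w. exp w *\<^sub>R f (exp w)"] leb int
    by (simp add: set_lebesgue_integral_def)
  also have "\<dots> = (LINT w|lborel. exp w *\<^sub>R f (exp w))"
    by (rule integral_completion) measurable
  finally show "(LINT t:{0<..}|lebesgue. f t) = (LINT w|lborel. exp w *\<^sub>R f (exp w))" .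
qed

section \<open>The kernel of the Gamma function in logarithmic coordinates\<close>

lemma of_real_exp_powr: "complex_of_real (exp w) powr z = exp (z * of_real w)"
  by (simp add: powr_def Ln_of_real del: exp_of_real)

text \<open>The integrand of Euler's integral \<open>\<integral> t\<^sup>b\<^sup>-\<^sup>1 exp (-a t) dt\<close> after \<open>t = exp w\<close>.\<close>

definition gamma_kernel :: "real \<Rightarrow> complex \<Rightarrow> real \<Rightarrow> complex" where
  "gamma_kernel a b w = exp (b * of_real w - of_real (a * exp w))"

lemma gamma_kernel_measurable [measurable]: "gamma_kernel a b \<in> borel_measurable borel"
  unfolding gamma_kernel_def by measurable

lemma norm_gamma_kernel: "norm (gamma_kernel a b w) = exp (Re b * w - a * exp w)"
  by (simp add: gamma_kernel_def norm_exp_eq_Re)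

lemma
  assumes b: "Re b > 0"
  shows integrable_gamma_kernel_1: "integrable lborel (gamma_kernel 1 b)"
    and integral_gamma_kernel_1: "(LINT w|lborel. gamma_kernel 1 b w) = Gamma b"
proof -
  define f where "f = (\<lambda>t. complex_of_real t powr (b - 1) / of_real (exp t))"
  have eq: "(\<lambda>w. exp w *\<^sub>R f (exp w)) = gamma_kernel 1 b"
  proof
    fix w
    have "complex_of_real (exp w) powr (b - 1) = exp ((b - 1) * of_real w)"
      by (rule of_real_exp_powr)
    thus "exp w *\<^sub>R f (exp w) = gamma_kernel 1 b w"
      by (simp add: f_def gamma_kernel_def scaleR_conv_of_real exp_diff left_diff_distrib exp_of_real)
  qed
  have int: "set_integrable lebesgue {0<..} f"
    unfolding f_def using absolutely_integrable_Gamma_integral'[OF b] .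
  show *: "integrable lborel (gamma_kernel 1 b)"
    using set_lebesgue_exp_substitution(1)[of f] int unfolding eq by simp
  have "Gamma b = (LINT t:{0<..}|lebesgue. f t)"
    using set_lebesgue_integral_eq_integral(2)[OF int] Gamma_integral_complex'[OF b]
    by (simp add: f_def integral_unique)
  also have "\<dots> = (LINT w|lborel. gamma_kernel 1 b w)"
    using set_lebesgue_exp_substitution(2)[of f] * unfolding eq by simp
  finally show "(LINT w|lborel. gamma_kernel 1 b w) = Gamma b" ..
qed

text \<open>Shifting \<open>w\<close> by \<open>ln a\<close> reduces a general \<open>a\<close> to \<open>a = 1\<close>.\<close>

lemma
  assumes a: "a > 0" and b: "Re b > 0"
  shows integrable_gamma_kernel: "integrable lborel (gamma_kernel a b)"
    and integral_gamma_kernel: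
      "(LINT w|lborel. gamma_kernel a b w) = Gamma b * of_real a powr (- b)"
proof -
  have shift: "gamma_kernel a b (- ln a + 1 * w) = of_real a powr (- b) * gamma_kernel 1 b w" for w
  proof -
    have "complex_of_real a powr (- b) = exp (- (b * of_real (ln a)))"
      using a by (simp add: powr_def Ln_of_real)
    moreover have "a * exp (- ln a + w) = exp w"
      using a by (simp add: exp_diff)
    ultimately show ?thesis
      unfolding gamma_kernel_def by (simp add: exp_add[symmetric] algebra_simps del: exp_of_real)
  qed
  show "integrable lborel (gamma_kernel a b)"
    using lborel_integrable_real_affine_iff[of 1 "gamma_kernel a b" "- ln a"]
    unfolding shift using integrable_gamma_kernel_1[OF b] by simp
  show "(LINT w|lborel. gamma_kernel a b w) = Gamma b * of_real a powr (- b)"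
    using lborel_integral_real_affine[of 1 "gamma_kernel a b" "- ln a"]
    unfolding shift using integral_gamma_kernel_1[OF b] by simp
qed

lemma norm_gamma_kernel_bounded:
  assumes a: "a > 0" and b: "Re b > 0"
  obtains B where "\<And>w. norm (gamma_kernel a b w) \<le> B"
proof
  fix w
  define r where "r = Re b"
  \<comment> \<open>Tangent line of the convex function \<open>exp\<close> at the point where the exponent is stationary.\<close>
  have "r * (1 + (w + ln (a / r))) \<le> r * exp (w + ln (a / r))"
    using b exp_ge_add_one_self by (intro mult_left_mono) (auto simp: r_def)
  also have "r * exp (w + ln (a / r)) = a * exp w"
    using a b by (simp add: exp_add r_def)
  finally have "r * w - a * exp w \<le> - r * (1 + ln (a / r))"
    by (simp add: algebra_simps)
  thus "norm (gamma_kernel a b w) \<le> exp (- r * (1 + ln (a / r)))"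
    unfolding norm_gamma_kernel r_def[symmetric] by simp
qed

lemma norm_Gamma_le_kernel_norm:
  assumes b: "Re b > 0"
  shows "norm (Gamma b) \<le> (LINT w|lborel. norm (gamma_kernel 1 (of_real (Re b)) w))"
proof -
  have "norm (Gamma b) \<le> (LINT w|lborel. norm (gamma_kernel 1 b w))"
    unfolding integral_gamma_kernel_1[OF b, symmetric] by (rule integral_norm_bound)
  thus ?thesis by (simp add: norm_gamma_kernel)
qed

lemma continuous_Gamma_vertical:
  assumes "\<sigma> > 0"
  shows "continuous_on UNIV (\<lambda>\<tau>. Gamma (Complex \<sigma> \<tau>))"
proof -
  have *: "Complex \<sigma> \<tau> \<notin> \<int>\<^sub>\<le>\<^sub>0" for \<tau>
    using assms by (auto elim!: nonpos_Ints_cases simp: complex_eq_iff)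
  show ?thesis
    by (rule continuous_on_compose2[OF continuous_on_Gamma[of "range (Complex \<sigma>)"]])
       (use * in \<open>auto intro!: continuous_intros simp: Complex_eq\<close>)
qed

lemma integrable_inverse_one_plus_square: "integrable lborel (\<lambda>x. 1 / (1 + x\<^sup>2) :: real)"
proof -
  have *: "integrable lborel (\<lambda>x. indicator {0<..} x *\<^sub>R (1 / (1 + x\<^sup>2)) :: real)"
    using integrable_I0i_1_div_plus_square
    by (simp add: interval_lebesgue_integrable_def set_integrable_def zero_ereal_def einterval_def greaterThan_def)
  have "integrable lborel (\<lambda>x. indicator {0<..} x *\<^sub>R (1 / (1 + x\<^sup>2))
      + indicator {0<..} (-x) *\<^sub>R (1 / (1 + (-x)\<^sup>2)) :: real)"
    using * lborel_integrable_real_affine[OF *, of "-1" 0] by (intro Bochner_Integration.integrable_add) auto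
  thus ?thesis
  proof (rule integrable_cong_AE_imp)
    show "AE x in lborel. indicator {0<..} x *\<^sub>R (1 / (1 + x\<^sup>2))
      + indicator {0<..} (-x) *\<^sub>R (1 / (1 + (-x)\<^sup>2)) = 1 / (1 + x\<^sup>2 :: real)"
      using AE_lborel_singleton[of "0::real"] by eventually_elim (auto simp: indicator_def)
  qed measurable
qed

text \<open>On a vertical line \<open>\<Gamma>\<close> is bounded by its integral representation. Applying this to the line through
  \<open>\<sigma> + 2\<close> and dividing by \<open>s (s + 1)\<close>, which has size at least \<open>\<bar>s\<bar>\<^sup>2\<close>, gives a bound by a multiple of
  \<open>1 / (1 + \<tau>\<^sup>2)\<close>. The constant \<open>m\<close> below compares \<open>\<sigma>\<^sup>2 + \<tau>\<^sup>2\<close> with \<open>1 + \<tau>\<^sup>2\<close>.\<close>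

theorem integrable_Gamma_vertical:
  assumes \<sigma>: "\<sigma> > 0"
  shows "integrable lborel (\<lambda>\<tau>. Gamma (Complex \<sigma> \<tau>))"
proof -
  define C where "C = (LINT w|lborel. norm (gamma_kernel 1 (of_real (\<sigma> + 2)) w))"
  define m where "m = min (\<sigma>\<^sup>2) 1"
  have m: "m > 0" "m \<le> \<sigma>\<^sup>2" "m \<le> 1" using \<sigma> by (auto simp: m_def)
  have meas: "(\<lambda>\<tau>. Gamma (Complex \<sigma> \<tau>)) \<in> borel_measurable borel"
    using continuous_Gamma_vertical[OF \<sigma>] by (rule borel_measurable_continuous_onI)
  have bound: "norm (Gamma (Complex \<sigma> \<tau>)) \<le> norm (C / m * (1 / (1 + \<tau>\<^sup>2)))" for \<tau>
  proof -
    define s where "s = Complex \<sigma> \<tau>"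
    have nz: "s \<noteq> 0" "s + 1 \<noteq> 0" using \<sigma> by (auto simp: s_def complex_eq_iff)
    have "s \<notin> \<int>\<^sub>\<le>\<^sub>0" "s + 1 \<notin> \<int>\<^sub>\<le>\<^sub>0"
      using \<sigma> by (auto elim!: nonpos_Ints_cases simp: s_def complex_eq_iff)
    hence "Gamma (s + 2) = (s + 1) * (s * Gamma s)"
      using Gamma_plus1[of s] Gamma_plus1[of "s + 1"] nz by (simp add: add.assoc)
    hence "norm (Gamma (s + 2)) = norm (s + 1) * norm s * norm (Gamma s)"
      by (simp add: norm_mult)
    moreover have "norm (Gamma (s + 2)) \<le> C"
      unfolding C_def using norm_Gamma_le_kernel_norm[of "s + 2"] \<sigma> by (simp add: s_def)
    moreover have "norm s * norm s \<le> norm (s + 1) * norm s"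
      using \<sigma> by (intro mult_right_mono) (auto simp: s_def cmod_def)
    moreover have "m * (1 + \<tau>\<^sup>2) \<le> norm s * norm s"
    proof -
      have "m * \<tau>\<^sup>2 \<le> 1 * \<tau>\<^sup>2" using m by (intro mult_right_mono) auto
      hence "m * (1 + \<tau>\<^sup>2) \<le> \<sigma>\<^sup>2 + \<tau>\<^sup>2" using m by (simp add: distrib_left)
      also have "\<dots> = norm s * norm s"
        by (simp add: s_def cmod_def flip: power2_eq_square)
      finally show ?thesis .
    qed
    ultimately have "m * (1 + \<tau>\<^sup>2) * norm (Gamma s) \<le> C"
      by (smt (verit) mult_right_mono norm_ge_zero)
    moreover have "C \<ge> 0" unfolding C_def by simp
    moreover have "m * (1 + \<tau>\<^sup>2) > 0" using m by (simp add: add_pos_nonneg)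
    ultimately have "norm (Gamma s) \<le> C / (m * (1 + \<tau>\<^sup>2))"
      by (simp add: pos_le_divide_eq mult.commute)
    thus ?thesis
      using m \<open>C \<ge> 0\<close> unfolding s_def by (simp add: abs_mult)
  qed
  show ?thesis
  proof (rule Bochner_Integration.integrable_bound)
    show "integrable lborel (\<lambda>\<tau>. C / m * (1 / (1 + \<tau>\<^sup>2)))"
      using integrable_inverse_one_plus_square by (intro integrable_mult_right) simp
  qed (use meas bound in auto)
qed

section \<open>Fourier transforms in products and correlations\<close>

lemma fourier_multiplication:
  assumes h: "integrable lborel h" and k: "integrable lborel k"
  shows "(LINT w|lborel. fourier h w * k w) = (LINT u|lborel. h u * fourier k u)"
proof -
  have [measurable]: "h \<in> borel_measurable borel" "k \<in> borel_measurable borel"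
    using borel_measurable_integrable[OF h] borel_measurable_integrable[OF k] by simp_all
  define K where "K = (\<lambda>(w, u). h u * k w * exp (- (\<i> * of_real (w * u))))"
  have [measurable]: "K \<in> borel_measurable (lborel \<Otimes>\<^sub>M lborel)"
    unfolding K_def by measurable
  have K: "integrable (lborel \<Otimes>\<^sub>M lborel) K"
  proof (rule lborel_pair.Fubini_integrable)
    have "norm (K (w, u)) = norm (k w) * norm (h u)" for w u
      unfolding K_def split norm_mult norm_exp_i_of_real by simp
    thus "integrable lborel (\<lambda>w. LINT u|lborel. norm (K (w, u)))"
      using k by simp
    have "integrable lborel (\<lambda>u. h u * (k w * exp (- (\<i> * of_real (w * u)))))" for w
      by (intro integrable_mult_bounded[where B = "norm (k w)"] h)
        (simp_all add: norm_mult)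
    thus "AE w in lborel. integrable lborel (\<lambda>u. K (w, u))"
      unfolding K_def by (simp add: mult_ac)
  qed measurable
  have "(LINT w|lborel. fourier h w * k w) = (LINT w|lborel. LINT u|lborel. K (w, u))"
    unfolding fourier_def K_def split integral_mult_left_zero[symmetric] by (simp add: mult_ac)
  also have "\<dots> = (LINT u|lborel. LINT w|lborel. K (w, u))"
    using K by (rule lborel_pair.Fubini_integral[of "\<lambda>w u. K (w, u)", simplified, symmetric])
  also have "\<dots> = (LINT u|lborel. h u * fourier k u)"
    by (simp add: fourier_def K_def mult_ac flip: integral_mult_right_zero)
  finally show ?thesis .
qed

text \<open>A variant of Young's inequality for \<open>L\<^sub>1\<close>: by Tonelli's theorem and translation invariance the
  norm of the double integrand factorises.\<close>

lemma
  assumes h: "integrable lborel h" and k: "integrable lborel (k :: real \<Rightarrow> complex)"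
  shows integrable_correlation: "integrable lborel (\<lambda>\<tau>. LINT u|lborel. h u * k (u + \<tau>))"
    and correlation_L1_norm_le:
      "(LINT \<tau>|lborel. norm (LINT u|lborel. h u * k (u + \<tau>)))
         \<le> (LINT u|lborel. norm (h u)) * (LINT v|lborel. norm (k v))"
proof -
  have [measurable]: "h \<in> borel_measurable borel" "k \<in> borel_measurable borel"
    using borel_measurable_integrable[OF h] borel_measurable_integrable[OF k] by simp_all
  define K where "K = (\<lambda>(u, \<tau>). h u * k (u + \<tau>))"
  have [measurable]: "K \<in> borel_measurable (lborel \<Otimes>\<^sub>M lborel)"
    unfolding K_def by measurable
  have k_shift: "integrable lborel (\<lambda>\<tau>. k (u + \<tau>))" for u
    using lborel_integrable_real_affine[OF k, of 1 u] by simp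
  have norm_K: "(LINT \<tau>|lborel. norm (K (u, \<tau>))) = norm (h u) * (LINT v|lborel. norm (k v))" for u
    using lborel_integral_real_affine[of 1 "\<lambda>v. norm (k v)" u] by (simp add: K_def norm_mult)
  have K: "integrable (lborel \<Otimes>\<^sub>M lborel) K"
  proof (rule lborel_pair.Fubini_integrable)
    show "integrable lborel (\<lambda>u. LINT \<tau>|lborel. norm (K (u, \<tau>)))"
      unfolding norm_K using h by simp
    show "AE u in lborel. integrable lborel (\<lambda>\<tau>. K (u, \<tau>))"
      unfolding K_def using k_shift by simp
  qed measurable
  have nK: "integrable (lborel \<Otimes>\<^sub>M lborel) (case_prod (\<lambda>u \<tau>. norm (K (u, \<tau>))))"
    using integrable_norm[OF K] by (simp add: case_prod_unfold)
  show int: "integrable lborel (\<lambda>\<tau>. LINT u|lborel. h u * k (u + \<tau>))"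
    using lborel_pair.integrable_snd[of "\<lambda>u \<tau>. K (u, \<tau>)"] K by (simp add: K_def)
  have "(LINT \<tau>|lborel. norm (LINT u|lborel. h u * k (u + \<tau>)))
      \<le> (LINT \<tau>|lborel. LINT u|lborel. norm (K (u, \<tau>)))"
  proof (rule integral_mono)
    show "integrable lborel (\<lambda>\<tau>. LINT u|lborel. norm (K (u, \<tau>)))"
      using nK by (rule lborel_pair.integrable_snd)
    show "norm (LINT u|lborel. h u * k (u + \<tau>)) \<le> (LINT u|lborel. norm (K (u, \<tau>)))" for \<tau>
      unfolding K_def split by (rule integral_norm_bound)
  qed (use int in auto)
  also have "\<dots> = (LINT u|lborel. LINT \<tau>|lborel. norm (K (u, \<tau>)))"
    using nK by (rule lborel_pair.Fubini_integral)
  also have "\<dots> = (LINT u|lborel. norm (h u)) * (LINT v|lborel. norm (k v))"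
    unfolding norm_K by simp
  finally show "(LINT \<tau>|lborel. norm (LINT u|lborel. h u * k (u + \<tau>)))
         \<le> (LINT u|lborel. norm (h u)) * (LINT v|lborel. norm (k v))" .
qed

text \<open>A character changes only the imaginary part of the parameter, so the Fourier transform of the kernel
  is the Gamma integral along a vertical line.\<close>

lemma gamma_kernel_modulate:
  "gamma_kernel a (b - \<i> * of_real \<tau>) w = gamma_kernel a b w * exp (- (\<i> * of_real (\<tau> * w)))"
  unfolding gamma_kernel_def by (simp add: exp_add[symmetric] algebra_simps del: exp_of_real)

lemma fourier_gamma_kernel:
  assumes "a > 0" "Re b > 0"
  shows "fourier (gamma_kernel a b) u = Gamma (b - \<i> * of_real u) * of_real a powr (- (b - \<i> * of_real u))"
  unfolding fourier_def gamma_kernel_modulate[symmetric]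
  using assms by (intro integral_gamma_kernel) auto

section \<open>The transformation in logarithmic coordinates\<close>

text \<open>The Mellin representation with \<open>x = exp w\<close>, where \<open>h\<close> is a Borel measurable
  version of the representing function along the line \<open>Re s = c\<close>. In this form the powers of \<open>x\<close>
  have become characters.\<close>

locale log_mellin_rep =
  fixes c :: real and f :: "real \<Rightarrow> complex" and h :: "real \<Rightarrow> complex"
  assumes h: "integrable lborel h"
    and log_rep: "\<And>w. of_real (exp (c * w)) * f (exp w) = fourier h w / (2 * of_real pi)"
begin

definition log_integrand :: "real \<Rightarrow> complex \<Rightarrow> real \<Rightarrow> complex" where
  "log_integrand a z w = fourier h w / (2 * of_real pi) * gamma_kernel a (1 - of_real c - z) w"

text \<open>The norm of \<open>f\<close> computed with the representing function \<open>h\<close>. It bounds \<open>exp (c w) \<bar>f (exp w)\<bar>\<close>.\<close>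

definition rep_norm :: real where "rep_norm = (LINT u|lborel. norm (h u)) / (2 * pi)"

lemma rep_norm_nonneg: "rep_norm \<ge> 0"
  by (simp add: rep_norm_def)

lemma norm_log_integrand_le: "norm (log_integrand a z w) \<le> rep_norm * norm (gamma_kernel a (1 - of_real c - z) w)"
  unfolding log_integrand_def norm_mult rep_norm_def
  using fourier_norm_le[of h w] by (intro mult_right_mono) (auto simp: norm_divide norm_mult divide_right_mono)

lemma continuous_log_integrand: "continuous_on UNIV (log_integrand a z)"
  unfolding log_integrand_def gamma_kernel_def
  by (intro continuous_intros continuous_fourier h) auto

lemma log_integrand_measurable [measurable]: "log_integrand a z \<in> borel_measurable borel"
  using continuous_log_integrand by (rule borel_measurable_continuous_onI)

lemma integrable_log_integrand:
  assumes "a > 0" "Re z < 1 - c"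
  shows "integrable lborel (log_integrand a z)"
proof (rule Bochner_Integration.integrable_bound)
  show "integrable lborel (\<lambda>w. rep_norm * norm (gamma_kernel a (1 - of_real c - z) w))"
    using assms by (intro integrable_mult_right integrable_norm integrable_gamma_kernel) auto
  show "AE w in lborel. norm (log_integrand a z w) \<le> norm (rep_norm * norm (gamma_kernel a (1 - of_real c - z) w))"
    using norm_log_integrand_le rep_norm_nonneg by (simp add: abs_mult)
qed simp

lemma exp_F_integrand: "exp w *\<^sub>R F_integrand a f z (exp w) = log_integrand a z w"
proof -
  have "complex_of_real (exp w) powr (- z) = exp (- (z * of_real w))"
    by (simp add: of_real_exp_powr)
  hence "exp w *\<^sub>R F_integrand a f z (exp w)
      = of_real (exp (c * w)) * f (exp w) *
        (exp (of_real w) * exp (- (z * of_real w)) * exp (- of_real (a * exp w)) * exp (- of_real (c * w)))"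
    unfolding F_integrand_def scaleR_conv_of_real
    by (simp add: exp_of_real exp_minus del: of_real_mult)
  also have "exp (of_real w) * exp (- (z * of_real w)) * exp (- of_real (a * exp w)) * exp (- of_real (c * w))
      = gamma_kernel a (1 - of_real c - z) w"
    unfolding gamma_kernel_def by (simp add: exp_add[symmetric] algebra_simps del: exp_of_real)
  finally show ?thesis unfolding log_rep log_integrand_def .
qed

lemma set_integrable_F_integrand:
  assumes "a > 0" "Re z < 1 - c"
  shows "set_integrable lebesgue {0<..} (F_integrand a f z)"
  using set_lebesgue_exp_substitution(1)[of "F_integrand a f z"] integrable_log_integrand[OF assms]
  unfolding exp_F_integrand by simp

lemma F_transform_log:
  assumes "a > 0" "Re z < 1 - c"
  shows "F_transform a f z = (LINT w|lborel. log_integrand a z w)"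
  using set_lebesgue_exp_substitution(2)[of "F_integrand a f z"] integrable_log_integrand[OF assms]
  unfolding exp_F_integrand F_transform_def by simp

text \<open>The Fourier transform is moved from \<open>h\<close> to the kernel.\<close>

lemma F_transform_eq_gamma_integral:
  assumes "a > 0" "Re z < 1 - c"
  shows "F_transform a f z
       = (LINT u|lborel. h u * fourier (gamma_kernel a (1 - of_real c - z)) u) / (2 * of_real pi)"
proof -
  have "F_transform a f z = (LINT w|lborel. fourier h w * gamma_kernel a (1 - of_real c - z) w) / (2 * of_real pi)"
    unfolding F_transform_log[OF assms] log_integrand_def by simp
  also have "(LINT w|lborel. fourier h w * gamma_kernel a (1 - of_real c - z) w)
      = (LINT u|lborel. h u * fourier (gamma_kernel a (1 - of_real c - z)) u)"
    using h assms by (intro fourier_multiplication integrable_gamma_kernel) auto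
  finally show ?thesis .
qed

text \<open>Here the transform stays on \<open>h\<close>, and the imaginary part of \<open>z\<close> acts as the frequency. This is the
  form to which Fourier inversion applies.\<close>

lemma F_transform_eq_fourier:
  assumes "a > 0" "\<gamma> < 1 - c"
  shows "F_transform a f (Complex \<gamma> \<tau>) = fourier (log_integrand a (of_real \<gamma>)) \<tau>"
proof -
  have "1 - of_real c - Complex \<gamma> \<tau> = (1 - of_real c - of_real \<gamma>) - \<i> * of_real \<tau>"
    by (simp add: complex_eq_iff)
  hence "log_integrand a (Complex \<gamma> \<tau>) w = log_integrand a (of_real \<gamma>) w * exp (- (\<i> * of_real (\<tau> * w)))" for w
    unfolding log_integrand_def by (simp only: gamma_kernel_modulate mult.assoc)
  thus ?thesis
    using assms by (simp add: F_transform_log fourier_def)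
qed

text \<open>Along a vertical line, the frequencies \<open>u\<close> of \<open>h\<close> and \<open>\<tau>\<close> of \<open>z\<close> enter the Gamma factor only through
  \<open>u + \<tau>\<close>, so the line integral is a correlation of two integrable functions.\<close>

lemma
  assumes a: "a > 0" and \<gamma>: "\<gamma> < 1 - c"
  shows integrable_F_transform_vertical: "integrable lborel (\<lambda>\<tau>. F_transform a f (Complex \<gamma> \<tau>))"
    and F_transform_vertical_L1_norm_le:
      "(LINT \<tau>|lborel. norm (F_transform a f (Complex \<gamma> \<tau>)))
         \<le> rep_norm * (LINT v|lborel. norm (fourier (gamma_kernel a (of_real (1 - c - \<gamma>))) v))"
proof -
  define b where "b = complex_of_real (1 - c - \<gamma>)"
  have b: "Re b > 0" using \<gamma> by (simp add: b_def)
  define k where "k = fourier (gamma_kernel a b)"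
  have norm_k: "norm (k v) = a powr (- Re b) * norm (Gamma (Complex (Re b) (- v)))" for v
  proof -
    have "b - \<i> * of_real v = Complex (Re b) (- v)" by (simp add: b_def complex_eq_iff)
    thus ?thesis
      using a unfolding k_def fourier_gamma_kernel[OF a b]
      by (simp add: norm_mult norm_powr_real_powr)
  qed
  have km: "k \<in> borel_measurable borel"
    unfolding k_def using continuous_fourier[OF integrable_gamma_kernel[OF a b]]
    by (rule borel_measurable_continuous_onI)
  have k: "integrable lborel k"
  proof (rule Bochner_Integration.integrable_bound)
    have "integrable lborel (\<lambda>v. Gamma (Complex (Re b) (- v)))"
      using lborel_integrable_real_affine[OF integrable_Gamma_vertical[OF b], of "-1" 0] by simp
    thus "integrable lborel (\<lambda>v. a powr (- Re b) * norm (Gamma (Complex (Re b) (- v))))"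
      by (intro integrable_mult_right integrable_norm)
  qed (use km norm_k in auto)
  have F: "F_transform a f (Complex \<gamma> \<tau>) = (LINT u|lborel. h u * k (u + \<tau>)) / (2 * of_real pi)" for \<tau>
  proof -
    have "1 - of_real c - Complex \<gamma> \<tau> = b - \<i> * of_real \<tau>"
      by (simp add: b_def complex_eq_iff)
    moreover have "fourier (gamma_kernel a (b - \<i> * of_real \<tau>)) u = k (u + \<tau>)" for u
      unfolding k_def fourier_def gamma_kernel_modulate
      by (simp add: mult.assoc exp_add[symmetric] algebra_simps)
    ultimately show ?thesis
      using a \<gamma> by (simp add: F_transform_eq_gamma_integral)
  qed
  show "integrable lborel (\<lambda>\<tau>. F_transform a f (Complex \<gamma> \<tau>))"
    unfolding F using integrable_correlation[OF h k] by simp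
  have "(LINT \<tau>|lborel. norm (F_transform a f (Complex \<gamma> \<tau>)))
      = (LINT \<tau>|lborel. norm (LINT u|lborel. h u * k (u + \<tau>))) / (2 * pi)"
    unfolding F by (simp add: norm_divide norm_mult)
  also have "\<dots> \<le> (LINT u|lborel. norm (h u)) * (LINT v|lborel. norm (k v)) / (2 * pi)"
    using correlation_L1_norm_le[OF h k] by (intro divide_right_mono) auto
  finally show "(LINT \<tau>|lborel. norm (F_transform a f (Complex \<gamma> \<tau>)))
         \<le> rep_norm * (LINT v|lborel. norm (fourier (gamma_kernel a (of_real (1 - c - \<gamma>))) v))"
    by (simp add: rep_norm_def k_def b_def)
qed

lemma F_transform_inversion:
  assumes a: "a > 0" and \<gamma>: "\<gamma> < 1 - c"
  shows "log_integrand a (of_real \<gamma>) w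
       = 1 / (2 * of_real pi) * (LINT \<tau>|lborel. F_transform a f (Complex \<gamma> \<tau>) * exp (\<i> * of_real (\<tau> * w)))"
proof -
  have "Re (1 - of_real c - of_real \<gamma>) > 0" using \<gamma> by simp
  then obtain B where B: "\<And>w. norm (gamma_kernel a (1 - of_real c - of_real \<gamma>) w) \<le> B"
    using norm_gamma_kernel_bounded[OF a] by blast
  have "norm (log_integrand a (of_real \<gamma>) w) \<le> rep_norm * B" for w
    using norm_log_integrand_le[of a "of_real \<gamma>" w] mult_left_mono[OF B[of w] rep_norm_nonneg] by linarith
  moreover have "isCont (log_integrand a (of_real \<gamma>)) w"
    using continuous_log_integrand by (simp add: continuous_on_eq_continuous_at)
  ultimately show ?thesis
    using integrable_F_transform_vertical[OF assms] \<gamma>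
    unfolding F_transform_eq_fourier[OF assms]
    by (intro fourier_inversion integrable_log_integrand a) auto
qed

text \<open>Integrals over the compact intervals \<open>[-n, n]\<close> can be differentiated under the integral sign. On a
  disc of radius \<open>d\<close> that is half as large as the distance of its centre to the boundary line, the
  exponent \<open>b\<close> of the kernel has real part between \<open>d\<close> and \<open>3 d\<close>. So the two kernels at these
  endpoints dominate all integrands at once, and their tails tend to zero.\<close>

lemma F_transform_holomorphic:
  assumes a: "a > 0"
  shows "F_transform a f holomorphic_on {z. Re z < 1 - c}"
proof -
  let ?S = "{z. Re z < 1 - c}"
  define Fn where "Fn = (\<lambda>n z. integral (cbox (- real n) (real n)) (log_integrand a z))"
  have P: "continuous_on A (\<lambda>x. fourier h (g x))" if "continuous_on A g" for A and g :: "complex \<times> real \<Rightarrow> real"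
    by (rule continuous_on_compose2[OF continuous_fourier[OF h] that]) auto
  have hol: "Fn n holomorphic_on UNIV" for n
    unfolding Fn_def
  proof (rule leibniz_rule_holomorphic)
    show "((\<lambda>z. log_integrand a z w) has_field_derivative - of_real w * log_integrand a z w) (at z within UNIV)"
      for z w
      unfolding log_integrand_def gamma_kernel_def
      by (auto intro!: derivative_eq_intros)
    show "log_integrand a z integrable_on cbox (- real n) (real n)" for z
      using continuous_on_subset[OF continuous_log_integrand] by (intro integrable_continuous) auto
    show "continuous_on (UNIV \<times> cbox (- real n) (real n)) (\<lambda>(z, w). - of_real w * log_integrand a z w)"
      unfolding log_integrand_def gamma_kernel_def case_prod_unfold
      by (intro continuous_intros P) auto
  qed auto
  have "F_transform a f holomorphic_on ?S"
  proof (rule holomorphic_uniform_sequence)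
    show "open ?S" by (rule open_halfspace_Re_lt)
    show "Fn n holomorphic_on ?S" for n using hol holomorphic_on_subset by blast
    fix z0 assume z0: "z0 \<in> ?S"
    define d where "d = (1 - c - Re z0) / 2"
    have d_twice: "1 - c - Re z0 = 2 * d" by (simp add: d_def)
    have d: "d > 0" using z0 by (simp add: d_def)
    define E where "E = (\<lambda>w. norm (gamma_kernel a (of_real d) w) + norm (gamma_kernel a (of_real (3 * d)) w))"
    have E: "integrable lborel E"
      unfolding E_def using a d
      by (intro Bochner_Integration.integrable_add integrable_norm integrable_gamma_kernel) auto
    have [measurable]: "E \<in> borel_measurable borel" using borel_measurable_integrable[OF E] by simp
    define D where "D = (\<lambda>n::nat. LINT w|lborel. indicator (- {- real n..real n}) w * E w)"
    have indE: "integrable lborel (\<lambda>w. indicator (- {- real n..real n}) w * E w)" for n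
      by (rule Bochner_Integration.integrable_bound[OF E]) (auto simp: indicator_def)
    have "D \<longlonglongrightarrow> (LINT w|(lborel :: real measure). 0)"
      unfolding D_def
    proof (rule integral_dominated_convergence[where w = E ])
      show "AE w in lborel. (\<lambda>n. indicator (- {- real n..real n}) w * E w) \<longlonglongrightarrow> 0"
      proof (rule always_eventually, rule allI)
        fix w
        obtain N where "\<bar>w\<bar> \<le> real N" using real_arch_simple by blast
        hence "\<forall>\<^sub>F n in sequentially. indicator (- {- real n..real n}) w * E w = 0"
          by (intro eventually_sequentiallyI[of N]) (auto simp: indicator_def)
        thus "(\<lambda>n. indicator (- {- real n..real n}) w * E w) \<longlonglongrightarrow> 0"
          by (rule tendsto_eventually)
      qed
    qed (use E in \<open>auto simp: indicator_def E_def\<close>)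
    hence D: "(\<lambda>n. rep_norm * D n) \<longlonglongrightarrow> 0"
      using tendsto_mult_right_zero by auto
    have Re_close: "\<bar>Re z - Re z0\<bar> \<le> d" if "z \<in> cball z0 d" for z
      using that abs_Re_le_cmod[of "z - z0"] by (auto simp: dist_norm norm_minus_commute)
    have S: "cball z0 d \<subseteq> ?S"
    proof
      fix z assume "z \<in> cball z0 d"
      from abs_le_D1[OF Re_close[OF this]] d show "z \<in> ?S"
        using d_twice unfolding mem_Collect_eq by linarith
    qed
    have bound: "norm (log_integrand a z w) \<le> rep_norm * E w" if z: "z \<in> cball z0 d" for z w
    proof -
      define \<beta> where "\<beta> = 1 - c - Re z"
      have \<beta>: "d \<le> \<beta>" "\<beta> \<le> 3 * d"
        using Re_close[OF z] d_twice unfolding \<beta>_def by linarith+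
      have "\<beta> * w \<le> d * w \<or> \<beta> * w \<le> 3 * d * w"
        using \<beta> by (cases "w \<ge> 0") (auto intro: mult_right_mono mult_right_mono_neg)
      hence "exp (\<beta> * w - a * exp w) \<le> exp (d * w - a * exp w) \<or>
             exp (\<beta> * w - a * exp w) \<le> exp (3 * d * w - a * exp w)"
        by simp
      hence "exp (\<beta> * w - a * exp w) \<le> exp (d * w - a * exp w) + exp (3 * d * w - a * exp w)"
        by (smt (verit) exp_gt_zero)
      hence "norm (gamma_kernel a (1 - of_real c - z) w) \<le> E w"
        by (simp add: norm_gamma_kernel E_def \<beta>_def)
      from mult_left_mono[OF this rep_norm_nonneg] show ?thesis
        using norm_log_integrand_le by (rule order_trans[rotated])
    qed
    have diff: "norm (Fn n z - F_transform a f z) \<le> rep_norm * D n" if z: "z \<in> cball z0 d" for n z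
    proof -
      have int: "integrable lborel (log_integrand a z)"
        using S z by (intro integrable_log_integrand a) auto
      hence si: "set_integrable lborel A (log_integrand a z)" if "A \<in> sets lborel" for A
        using that unfolding set_integrable_def by (rule integrable_mult_indicator[rotated])
      have "F_transform a f z = (LINT w:{- real n..real n}|lborel. log_integrand a z w)
          + (LINT w:- {- real n..real n}|lborel. log_integrand a z w)"
        using set_integral_Un[OF _ si si, of "{- real n..real n}" "- {- real n..real n}"] S z a
        by (simp add: F_transform_log Compl_partition set_lebesgue_integral_def[of _ UNIV] subset_iff)
      moreover have "(LINT w:{- real n..real n}|lborel. log_integrand a z w) = Fn n z"
        unfolding Fn_def using si by (simp add: set_borel_integral_eq_integral(2))
      ultimately have "norm (Fn n z - F_transform a f z)
          = norm (LINT w|lborel. indicator (- {- real n..real n}) w *\<^sub>R log_integrand a z w)"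
        by (simp add: set_lebesgue_integral_def)
      also have "\<dots> \<le> (LINT w|lborel. norm (indicator (- {- real n..real n}) w *\<^sub>R log_integrand a z w))"
        by (rule integral_norm_bound)
      also have "\<dots> \<le> (LINT w|lborel. rep_norm * (indicator (- {- real n..real n}) w * E w))"
        using si[of "- {- real n..real n}"] indE bound[OF z]
        by (intro integral_mono integrable_norm integrable_mult_right)
           (auto simp: indicator_def set_integrable_def)
      also have "\<dots> = rep_norm * D n" unfolding D_def by simp
      finally show ?thesis .
    qed
    have "uniform_limit (cball z0 d) Fn (F_transform a f) sequentially"
    proof (rule uniform_limitI)
      fix e :: real assume "e > 0"
      with D have "\<forall>\<^sub>F n in sequentially. rep_norm * D n < e" by (rule order_tendstoD)
      thus "\<forall>\<^sub>F n in sequentially. \<forall>z\<in>cball z0 d. dist (Fn n z) (F_transform a f z) < e"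
        unfolding dist_norm by eventually_elim (blast intro: le_less_trans diff)
    qed
    with d S show "\<exists>d>0. cball z0 d \<subseteq> ?S \<and> uniform_limit (cball z0 d) Fn (F_transform a f) sequentially"
      by blast
  qed
  thus ?thesis .
qed

end

section \<open>Integrals along vertical lines\<close>

lemma mellin_rep_imp_log_mellin_rep:
  assumes rep: "mellin_rep c f fs"
  obtains h where "log_mellin_rep c f h" "AE t in lebesgue. fs (Complex c t) = h t"
proof -
  have int: "integrable lebesgue (\<lambda>t. fs (Complex c t))"
    using rep by (simp add: mellin_rep_def vline_L1_def)
  then obtain h where h: "integrable lborel h" "AE t in lebesgue. fs (Complex c t) = h t"
    by (rule integrable_lebesgue_borel_representative)
  have "log_mellin_rep c f h"
  proof
    fix w
    have powr: "complex_of_real (exp w) powr (- Complex c t)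
        = of_real (exp (- (c * w))) * exp (- (\<i> * of_real (w * t)))" for t
    proof -
      have "- Complex c t * of_real w = of_real (- (c * w)) + - (\<i> * of_real (w * t))"
        by (simp add: complex_eq_iff)
      thus ?thesis by (simp only: of_real_exp_powr exp_add exp_of_real)
    qed
    have "f (exp w) = (LINT t|lebesgue. fs (Complex c t) * complex_of_real (exp w) powr (- Complex c t))
        / (2 * of_real pi)"
      using rep by (simp add: mellin_rep_def vline_integral_def)
    also have "(LINT t|lebesgue. fs (Complex c t) * complex_of_real (exp w) powr (- Complex c t))
        = of_real (exp (- (c * w))) * (LINT t|lebesgue. fs (Complex c t) * exp (- (\<i> * of_real (w * t))))"
      unfolding powr by (simp add: mult.left_commute del: of_real_mult flip: integral_mult_right_zero)
    also have "(LINT t|lebesgue. fs (Complex c t) * exp (- (\<i> * of_real (w * t)))) = fourier h w"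
      unfolding fourier_def
      by (rule lebesgue_mult_cong_representative[OF int h, where B = 1]) auto
    finally show "of_real (exp (c * w)) * f (exp w) = fourier h w / (2 * of_real pi)"
      by (simp add: mult.assoc[symmetric] exp_minus flip: of_real_mult)
  qed (rule h)
  thus ?thesis using h that by blast
qed

lemma vline_L1_norm_cong_representative:
  assumes "fs \<in> vline_L1 c" "integrable lborel h" "AE t in lebesgue. fs (Complex c t) = h t"
  shows "vline_L1_norm c fs = (LINT t|lborel. norm (h t))"
proof -
  have hm: "(\<lambda>t. norm (h t)) \<in> borel_measurable lborel"
    using borel_measurable_integrable[OF assms(2)] by measurable
  have "(\<lambda>t. fs (Complex c t)) \<in> borel_measurable lebesgue"
    using assms(1) borel_measurable_integrable unfolding vline_L1_def by blast
  hence "vline_L1_norm c fs = (LINT t|lebesgue. norm (h t))"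
    unfolding vline_L1_norm_def
    by (intro integral_cong_AE) (use assms hm in \<open>auto intro: measurable_completion\<close>)
  also have "\<dots> = (LINT t|lborel. norm (h t))"
    using hm by (rule integral_completion)
  finally show ?thesis .
qed

lemma integrable_lborel_imp_lebesgue:
  fixes g :: "real \<Rightarrow> 'a :: {banach, second_countable_topology}"
  assumes "integrable lborel g"
  shows "integrable lebesgue g" "(LINT t|lebesgue. g t) = (LINT t|lborel. g t)"
  using assms borel_measurable_integrable[OF assms]
  by (auto simp: integrable_completion integral_completion)

definition Gamma_vline_L1 :: "real \<Rightarrow> real" where
  "Gamma_vline_L1 \<sigma> = (LINT \<tau>|lebesgue. norm (Gamma (of_real \<sigma> - \<i> * of_real \<tau>)))"

lemma
  assumes "\<sigma> > 0"
  shows integrable_norm_Gamma_vline: "integrable lebesgue (\<lambda>\<tau>. norm (Gamma (of_real \<sigma> - \<i> * of_real \<tau>)))"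
    and L1_norm_fourier_gamma_kernel: "a > 0 \<Longrightarrow>
      (LINT v|lborel. norm (fourier (gamma_kernel a (of_real \<sigma>)) v)) = a powr (- \<sigma>) * Gamma_vline_L1 \<sigma>"
proof -
  have eq: "of_real \<sigma> - \<i> * of_real \<tau> = Complex \<sigma> (0 + -1 * \<tau>)" for \<tau>
    by (simp add: complex_eq_iff)
  have int: "integrable lborel (\<lambda>\<tau>. norm (Gamma (of_real \<sigma> - \<i> * of_real \<tau>)))"
    unfolding eq by (intro integrable_norm lborel_integrable_real_affine[OF integrable_Gamma_vertical[OF assms]]) auto
  thus "integrable lebesgue (\<lambda>\<tau>. norm (Gamma (of_real \<sigma> - \<i> * of_real \<tau>)))"
    by (rule integrable_lborel_imp_lebesgue)
  assume a: "a > 0"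
  have "norm (fourier (gamma_kernel a (of_real \<sigma>)) v) = a powr (- \<sigma>) * norm (Gamma (of_real \<sigma> - \<i> * of_real v))" for v
    using a assms by (simp add: fourier_gamma_kernel norm_mult norm_powr_real_powr)
  thus "(LINT v|lborel. norm (fourier (gamma_kernel a (of_real \<sigma>)) v)) = a powr (- \<sigma>) * Gamma_vline_L1 \<sigma>"
    using integrable_lborel_imp_lebesgue(2)[OF int] by (simp add: Gamma_vline_L1_def)
qed

text \<open>The bound is proved for an arbitrary representing function. It therefore does not matter which one
  the norm on the space selects.\<close>

lemma F_transform_vline_bound:
  assumes a: "a > 0" and \<gamma>: "\<gamma> < 1 - c" and rep: "mellin_rep c f fs"
  shows "F_transform a f \<in> vline_L1 \<gamma>"
    and "vline_L1_norm \<gamma> (F_transform a f)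
      \<le> a powr (\<gamma> + c - 1) * Gamma_vline_L1 (1 - c - \<gamma>) * (1 / (2 * pi) * vline_L1_norm c fs)"
proof -
  obtain h where "log_mellin_rep c f h" and ae: "AE t in lebesgue. fs (Complex c t) = h t"
    using mellin_rep_imp_log_mellin_rep[OF rep] .
  then interpret log_mellin_rep c f h by simp
  note F = integrable_F_transform_vertical[OF a \<gamma>]
  show "F_transform a f \<in> vline_L1 \<gamma>"
    unfolding vline_L1_def using integrable_lborel_imp_lebesgue(1)[OF F] by simp
  have "vline_L1_norm \<gamma> (F_transform a f) = (LINT \<tau>|lborel. norm (F_transform a f (Complex \<gamma> \<tau>)))"
    unfolding vline_L1_norm_def by (rule integrable_lborel_imp_lebesgue(2)[OF integrable_norm[OF F]])
  also have "\<dots> \<le> rep_norm * (a powr (- (1 - c - \<gamma>)) * Gamma_vline_L1 (1 - c - \<gamma>))"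
    using F_transform_vertical_L1_norm_le[OF a \<gamma>] L1_norm_fourier_gamma_kernel[of "1 - c - \<gamma>" a] a \<gamma> by simp
  also have "rep_norm = 1 / (2 * pi) * vline_L1_norm c fs"
    using vline_L1_norm_cong_representative[OF _ h ae] rep by (simp add: rep_norm_def mellin_rep_def)
  also have "- (1 - c - \<gamma>) = \<gamma> + c - 1" by simp
  finally show "vline_L1_norm \<gamma> (F_transform a f)
      \<le> a powr (\<gamma> + c - 1) * Gamma_vline_L1 (1 - c - \<gamma>) * (1 / (2 * pi) * vline_L1_norm c fs)"
    by (simp add: mult_ac)
qed

lemma F_transform_Minv_bound:
  assumes "a > 0" "\<gamma> < 1 - c" "f \<in> Minv c"
  shows "vline_L1_norm \<gamma> (F_transform a f)
      \<le> a powr (\<gamma> + c - 1) * Gamma_vline_L1 (1 - c - \<gamma>) * Minv_norm c f"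
proof -
  have "mellin_rep c f (SOME fs. mellin_rep c f fs)"
    using assms(3) unfolding Minv_def by (simp add: someI_ex)
  from F_transform_vline_bound(2)[OF assms(1,2) this] show ?thesis
    unfolding Minv_norm_def .
qed

lemma F_transform_linear:
  assumes a: "a > 0" and z: "Re z < 1 - c" and f: "f \<in> Minv c" and g: "g \<in> Minv c"
  shows "F_transform a (\<lambda>x. \<alpha> * f x + \<beta> * g x) z = \<alpha> * F_transform a f z + \<beta> * F_transform a g z"
proof -
  have int: "set_integrable lebesgue {0<..} (F_integrand a u z)" if "u \<in> Minv c" for u
  proof -
    obtain us where "mellin_rep c u us" using \<open>u \<in> Minv c\<close> by (auto simp: Minv_def)
    then obtain h where "log_mellin_rep c u h" by (rule mellin_rep_imp_log_mellin_rep)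
    thus ?thesis using a z by (rule log_mellin_rep.set_integrable_F_integrand)
  qed
  have "F_integrand a (\<lambda>x. \<alpha> * f x + \<beta> * g x) z
      = (\<lambda>t. \<alpha> * F_integrand a f z t + \<beta> * F_integrand a g z t)"
    by (simp add: F_integrand_def algebra_simps fun_eq_iff)
  thus ?thesis
    unfolding F_transform_def using int[OF f] int[OF g] by (simp add: set_integral_add)
qed

lemma F_transform_bounded_operator:
  assumes a: "a > 0" and \<gamma>: "\<gamma> < 1 - c"
  shows "bounded_operator c \<gamma> (F_transform a)"
    and "operator_norm c \<gamma> (F_transform a) \<le> a powr (\<gamma> + c - 1) * Gamma_vline_L1 (1 - c - \<gamma>)"
proof -
  show "bounded_operator c \<gamma> (F_transform a)"
    unfolding bounded_operator_def
  proof (intro conjI ballI allI impI)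
    show "F_transform a f \<in> vline_L1 \<gamma>" if "f \<in> Minv c" for f
      using that F_transform_vline_bound(1)[OF a \<gamma>] by (auto simp: Minv_def)
    show "\<exists>K. \<forall>f\<in>Minv c. vline_L1_norm \<gamma> (F_transform a f) \<le> K * Minv_norm c f"
      using F_transform_Minv_bound[OF a \<gamma>] by blast
  qed (use a \<gamma> in \<open>auto intro: F_transform_linear\<close>)
  show "operator_norm c \<gamma> (F_transform a) \<le> a powr (\<gamma> + c - 1) * Gamma_vline_L1 (1 - c - \<gamma>)"
    unfolding operator_norm_def
  proof (rule cInf_lower)
    have "Gamma_vline_L1 (1 - c - \<gamma>) \<ge> 0" by (simp add: Gamma_vline_L1_def)
    thus "a powr (\<gamma> + c - 1) * Gamma_vline_L1 (1 - c - \<gamma>)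
        \<in> {K. 0 \<le> K \<and> (\<forall>f\<in>Minv c. vline_L1_norm \<gamma> (F_transform a f) \<le> K * Minv_norm c f)}"
      using F_transform_Minv_bound[OF a \<gamma>] by auto
    show "bdd_below {K. 0 \<le> K \<and> (\<forall>f\<in>Minv c. vline_L1_norm \<gamma> (F_transform a f) \<le> K * Minv_norm c f)}"
      by (rule bdd_belowI[of _ 0]) auto
  qed
qed

lemma F_transform_eq_vline_integral:
  assumes a: "a > 0" and z: "Re z < 1 - c" and rep: "mellin_rep c f fs"
  defines "I \<equiv> \<lambda>s. Gamma (1 - s - z) * fs s * of_real a powr (z + s - 1)"
  shows "I \<in> vline_L1 c"
    and "F_transform a f z = 1 / (2 * of_real pi * \<i>) * vline_integral c I"
proof -
  obtain h where "log_mellin_rep c f h" and ae: "AE t in lebesgue. fs (Complex c t) = h t"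
    using mellin_rep_imp_log_mellin_rep[OF rep] .
  then interpret log_mellin_rep c f h by simp
  define b where "b = 1 - of_real c - z"
  have b: "Re b > 0" using z by (simp add: b_def)
  define k where "k = fourier (gamma_kernel a b)"
  have I: "I (Complex c u) = fs (Complex c u) * k u" for u
  proof -
    have "1 - Complex c u - z = b - \<i> * of_real u" "z + Complex c u - 1 = - (b - \<i> * of_real u)"
      by (simp_all add: b_def complex_eq_iff)
    thus ?thesis
      by (simp only: I_def k_def fourier_gamma_kernel[OF a b]) (simp add: mult_ac)
  qed
  have int: "integrable lebesgue (\<lambda>t. fs (Complex c t))"
    using rep by (simp add: mellin_rep_def vline_L1_def)
  have km: "k \<in> borel_measurable borel"
    unfolding k_def using continuous_fourier[OF integrable_gamma_kernel[OF a b]]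
    by (rule borel_measurable_continuous_onI)
  note rep' = lebesgue_mult_cong_representative[OF int h ae km fourier_norm_le[of "gamma_kernel a b", folded k_def]]
  show "I \<in> vline_L1 c"
    unfolding vline_L1_def mem_Collect_eq I by (rule rep'(1))
  show "F_transform a f z = 1 / (2 * of_real pi * \<i>) * vline_integral c I"
    unfolding vline_integral_def I rep'(3)
    unfolding F_transform_eq_gamma_integral[OF a z] k_def b_def by simp
qed

text \<open>Fourier inversion at the point \<open>w = ln x\<close>.\<close>

lemma F_transform_inversion_vline:
  assumes a: "a > 0" and \<gamma>: "\<gamma> < 1 - c" and x: "x > 0" and rep: "mellin_rep c f fs"
  defines "I \<equiv> \<lambda>z. F_transform a f z * of_real x powr (z - 1)"
  shows "I \<in> vline_L1 \<gamma>"
    and "f x = of_real (exp (a * x)) / (2 * of_real pi * \<i>) * vline_integral \<gamma> I"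
proof -
  obtain h where "log_mellin_rep c f h" and ae: "AE t in lebesgue. fs (Complex c t) = h t"
    using mellin_rep_imp_log_mellin_rep[OF rep] .
  then interpret log_mellin_rep c f h by simp
  define w where "w = ln x"
  have x_eq: "x = exp w" using x by (simp add: w_def)
  define Fe where "Fe = (\<lambda>\<tau>. F_transform a f (Complex \<gamma> \<tau>) * exp (\<i> * of_real (\<tau> * w)))"
  have I: "I (Complex \<gamma> \<tau>) = of_real (exp ((\<gamma> - 1) * w)) * Fe \<tau>" for \<tau>
  proof -
    have "(Complex \<gamma> \<tau> - 1) * of_real w = of_real ((\<gamma> - 1) * w) + \<i> * of_real (\<tau> * w)"
      by (simp add: complex_eq_iff)
    thus ?thesis
      by (simp only: I_def Fe_def x_eq of_real_exp_powr exp_add exp_of_real) (simp add: mult_ac)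
  qed
  have Fe: "integrable lborel Fe"
    unfolding Fe_def
    by (rule integrable_mult_bounded[OF integrable_F_transform_vertical[OF a \<gamma>], where B = 1]) auto
  note Fe_leb = integrable_lborel_imp_lebesgue[OF Fe]
  show "I \<in> vline_L1 \<gamma>"
    unfolding vline_L1_def mem_Collect_eq I using Fe_leb(1) by (intro integrable_mult_right)
  have "log_integrand a (of_real \<gamma>) w = 1 / (2 * of_real pi) * (LINT \<tau>|lborel. Fe \<tau>)"
    unfolding Fe_def by (rule F_transform_inversion[OF a \<gamma>])
  moreover have "log_integrand a (of_real \<gamma>) w
      = of_real (exp w * exp (- \<gamma> * w) * exp (- a * x)) * f x"
    unfolding exp_F_integrand[symmetric] F_integrand_def x_eq of_real_exp_powr scaleR_conv_of_real
    by (simp add: exp_of_real[symmetric] mult_ac)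
  ultimately have "of_real (exp w * exp (- \<gamma> * w) * exp (- a * x)) * f x
      = 1 / (2 * of_real pi) * (LINT \<tau>|lborel. Fe \<tau>)" by simp
  hence "of_real (exp (a * x) * exp ((\<gamma> - 1) * w)) * (of_real (exp w * exp (- \<gamma> * w) * exp (- a * x)) * f x)
      = of_real (exp (a * x) * exp ((\<gamma> - 1) * w)) * (1 / (2 * of_real pi) * (LINT \<tau>|lborel. Fe \<tau>))"
    by simp
  moreover have "exp (a * x) * exp ((\<gamma> - 1) * w) * (exp w * exp (- \<gamma> * w) * exp (- a * x)) = 1"
    by (simp add: exp_add[symmetric] algebra_simps)
  ultimately have "f x = of_real (exp (a * x) * exp ((\<gamma> - 1) * w)) * (1 / (2 * of_real pi) * (LINT \<tau>|lborel. Fe \<tau>))"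
    by (metis mult.assoc of_real_1 of_real_mult mult_1)
  thus "f x = of_real (exp (a * x)) / (2 * of_real pi * \<i>) * vline_integral \<gamma> I"
    unfolding vline_integral_def I using Fe_leb(2) by simp
qed

lemma F_transform_analytic:
  assumes "a > 0" "mellin_rep c f fs"
  shows "F_transform a f analytic_on {z. Re z < 1 - c}"
proof -
  obtain h where "log_mellin_rep c f h"
    using mellin_rep_imp_log_mellin_rep[OF assms(2)] .
  thus ?thesis
    using log_mellin_rep.F_transform_holomorphic assms(1)
    by (simp add: analytic_on_open open_halfspace_Re_lt)
qed

theorem theorem1:
  fixes a c0 :: real and f :: "real \<Rightarrow> complex" and fs :: "complex \<Rightarrow> complex"
  assumes "a > 0" and "c0 < 1" and "f \<in> Minv c0" and "mellin_rep c0 f fs"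
  shows "(\<forall>z. Re z < 1 - c0 \<longrightarrow> set_integrable lebesgue {0<..} (F_integrand a f z))
    \<and> F_transform a f analytic_on {z. Re z < 1 - c0}
    \<and> (\<forall>z. Re z < 1 - c0 \<longrightarrow>
         (\<lambda>s. Gamma (1 - s - z) * fs s * of_real a powr (z + s - 1)) \<in> vline_L1 c0 \<and>
         F_transform a f z = 1 / (2 * of_real pi * \<i>) *
           vline_integral c0 (\<lambda>s. Gamma (1 - s - z) * fs s * of_real a powr (z + s - 1)))
    \<and> (\<forall>\<gamma>. \<gamma> < 1 - c0 \<longrightarrow>
         bounded_operator c0 \<gamma> (F_transform a) \<and>
         integrable lebesgue (\<lambda>\<tau>. cmod (Gamma (of_real (1 - c0 - \<gamma>) - \<i> * of_real \<tau>))) \<and>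
         operator_norm c0 \<gamma> (F_transform a) \<le>
           a powr (\<gamma> + c0 - 1) *
             (LINT \<tau>|lebesgue. cmod (Gamma (of_real (1 - c0 - \<gamma>) - \<i> * of_real \<tau>))))
    \<and> (\<forall>\<gamma> x. \<gamma> < 1 - c0 \<and> x > 0 \<longrightarrow>
         (\<lambda>z. F_transform a f z * of_real x powr (z - 1)) \<in> vline_L1 \<gamma> \<and>
         f x = of_real (exp (a * x)) / (2 * of_real pi * \<i>) *
           vline_integral \<gamma> (\<lambda>z. F_transform a f z * of_real x powr (z - 1)))"
proof -
  obtain h where "log_mellin_rep c0 f h"
    using mellin_rep_imp_log_mellin_rep[OF assms(4)] .
  hence "\<forall>z. Re z < 1 - c0 \<longrightarrow> set_integrable lebesgue {0<..} (F_integrand a f z)"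
    using assms(1) log_mellin_rep.set_integrable_F_integrand by blast
  moreover have "integrable lebesgue (\<lambda>\<tau>. cmod (Gamma (of_real (1 - c0 - \<gamma>) - \<i> * of_real \<tau>)))"
    if "\<gamma> < 1 - c0" for \<gamma>
    using that by (intro integrable_norm_Gamma_vline) simp
  ultimately show ?thesis
    using assms(1,4) F_transform_analytic F_transform_eq_vline_integral F_transform_bounded_operator
      F_transform_inversion_vline
    unfolding Gamma_vline_L1_def by (intro conjI allI impI) auto
qed

end
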